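(* Let $G$ be a finite group. Let $P_2(G)$ be the set of non-identity elements of $G$ whose orders are either prime or the product of two (not necessarily distinct) prime numbers. Then the power graph $P(G)$ is a cograph if and only if the subgraph of $P(G)$ induced on $P_2(G)$ is a cograph.
   Context: The (undirected) power graph $P(G)$ of a finite group $G$ is the simple graph with vertex set $G$ in which two distinct vertices $u,v$ are adjacent if and only if one of $u,v$ is a power of the other. A graph is a cograph if it has no induced subgraph isomorphic to the path $P_4$ on four vertices. *)

theory Defs
  imports
    "HOL-Algebra.Multiplicative_Group"
    "HOL-Computational_Algebra.Primes"
    "Graph_Theory.Digraph_Isomorphism"
begin

text \<open>
  Simple graphs are represented, as in \<open>Graph_Theory\<close>, by symmetric loop-free digraphs
  (locales \<open>pair_graph\<close> and \<open>graph\<close>): each edge is a pair of opposite arcs.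
\<close>

definition power_graph :: "('a, 'b) monoid_scheme \<Rightarrow> 'a pair_pre_digraph" where
  "power_graph G =
     \<lparr> pverts = carrier G,
       parcs = {(u, v). u \<in> carrier G \<and> v \<in> carrier G \<and> u \<noteq> v \<and>
         ((\<exists>n::nat. u = v [^]\<^bsub>G\<^esub> n) \<or> (\<exists>n::nat. v = u [^]\<^bsub>G\<^esub> n))} \<rparr>"

definition path_graph :: "nat \<Rightarrow> nat pair_pre_digraph" where
  "path_graph n =
     \<lparr> pverts = {..<n},
       parcs = {(i, j). i < n \<and> j < n \<and> (j = Suc i \<or> i = Suc j)} \<rparr>"

definition cograph :: "('a, 'b) pre_digraph \<Rightarrow> bool" where
  "cograph \<Gamma> \<longleftrightarrow> \<not> (\<exists>H. induced_subgraph H \<Gamma> \<and> digraph_iso (with_proj (path_graph 4)) H)"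

definition P2_set :: "('a, 'b) monoid_scheme \<Rightarrow> 'a set" where
  "P2_set G =
     {x \<in> carrier G. x \<noteq> \<one>\<^bsub>G\<^esub> \<and>
        (prime (group.ord G x) \<or>
         (\<exists>p q::nat. prime p \<and> prime q \<and> group.ord G x = p * q))}"

text \<open>
  The predicate \<^const>\<open>induced_subgraph\<close> requires both graphs to be well-formed; the following
  facts show that this holds for the graphs considered here.
\<close>

lemma pair_graph_power_graph:
  assumes "finite (carrier G)"
  shows "pair_graph (power_graph G)"
proof -
  have "finite (parcs (power_graph G))"
    by (rule finite_subset[of _ "carrier G \<times> carrier G"]) (auto simp: power_graph_def assms)
  moreover have "symmetric (with_proj (power_graph G))"
    by (auto simp: symmetric_def power_graph_def intro!: symI)
  ultimately show ?thesis
    by unfold_locales (auto simp: power_graph_def assms)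
qed

lemma pair_graph_path_graph: "pair_graph (path_graph n)"
proof -
  have "finite (parcs (path_graph n))"
    by (rule finite_subset[of _ "{..<n} \<times> {..<n}"]) (auto simp: path_graph_def)
  moreover have "symmetric (with_proj (path_graph n))"
    by (auto simp: symmetric_def path_graph_def intro!: symI)
  ultimately show ?thesis
    by unfold_locales (auto simp: path_graph_def)
qed

lemma P2_set_subset_verts: "P2_set G \<subseteq> pverts (power_graph G)"
  by (auto simp: P2_set_def power_graph_def)

end

theory Submission
  imports Defs
begin

text \<open>
  Write \<open>x \<rightarrow> y\<close> if \<open>y\<close> is a power of \<open>x\<close>. This relation is transitive, so an induced path on four
  vertices is, up to reversal, of the form \<open>a \<leftarrow> b \<rightarrow> c \<leftarrow> d\<close>. Two powers of the same element are related
  exactly if one order divides the other. Hence an element whose order is divisible by \<open>u v w\<close> for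
  primes with \<open>u \<noteq> v\<close> and \<open>u \<noteq> w\<close> has powers of orders \<open>u\<close>, \<open>u v\<close>, \<open>v\<close>, \<open>v w\<close>, and these form an
  induced path. If there is no such element, then in a given path \<open>b\<close> has order \<open>p r\<close> with \<open>p \<noteq> r\<close>,
  while \<open>c\<close> and \<open>a\<close> have orders \<open>p\<close> and \<open>r\<close>; it then suffices to replace \<open>d\<close> by a power of order
  \<open>p q\<close> with \<open>q\<close> prime.
\<close>

section \<open>Cographs via four vertices that span an induced path\<close>

definition induced_P4 :: "'a rel \<Rightarrow> 'a set \<Rightarrow> 'a \<Rightarrow> 'a \<Rightarrow> 'a \<Rightarrow> 'a \<Rightarrow> bool" where
  "induced_P4 E S a b c d \<longleftrightarrow> {a, b, c, d} \<subseteq> S \<and>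
     (a, b) \<in> E \<and> (b, c) \<in> E \<and> (c, d) \<in> E \<and> (a, c) \<notin> E \<and> (a, d) \<notin> E \<and> (b, d) \<notin> E"

lemma induced_P4_mono: "induced_P4 E S a b c d \<Longrightarrow> S \<subseteq> T \<Longrightarrow> induced_P4 E T a b c d"
  by (auto simp: induced_P4_def)

text \<open>Trades the isomorphism with \<open>path_graph 4\<close> for six adjacency conditions on
  four vertices, the form in which the group theory below works.\<close>

lemma (in pair_graph) cograph_iff_no_induced_P4:
  "cograph (with_proj G) \<longleftrightarrow> (\<nexists>a b c d. induced_P4 (parcs G) (pverts G) a b c d)"
proof -
  have sym: "(v, u) \<in> parcs G" if "(u, v) \<in> parcs G" for u v
    using that by (rule arcs_symmetric)
  have irrefl: "(u, u) \<notin> parcs G" for u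
    using no_loops[of "(u, u)"] by auto
  interpret path: pair_graph "path_graph 4"
    by (rule pair_graph_path_graph)
  have "\<exists>a b c d. induced_P4 (parcs G) (pverts G) a b c d"
    if ind: "induced_subgraph H (with_proj G)"
      and iso: "digraph_iso (with_proj (path_graph 4)) H" for H
  proof -
    obtain h where h: "path.digraph_isomorphism h" and H: "H = app_iso h (with_proj (path_graph 4))"
      using iso by (auto simp: digraph_iso_def)
    define f where "f = iso_verts h"
    have f_inj: "inj_on f {..<4}"
      using h unfolding path.digraph_isomorphism_def by (simp add: f_def path_graph_def)
    \<comment> \<open>\<open>induced_subgraph\<close> includes \<open>compatible\<close>, so
      \<open>H\<close> keeps the projections of \<open>with_proj G\<close>. Hence its arcs are
      genuine pairs and \<open>h\<close> acts on arcs through \<open>f\<close>.\<close>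
    have ends: "iso_tail h = fst" "iso_head h = snd"
      using ind by (auto simp: H induced_subgraph_def subgraph_def compatible_def)
    have arcs_h: "iso_arcs h e = (f (fst e), f (snd e))" if "e \<in> parcs (path_graph 4)" for e
      using h that by (auto simp: path.digraph_isomorphism_def f_def ends prod_eq_iff)
    have arcs_H: "iso_arcs h ` parcs (path_graph 4) =
        {e \<in> parcs G. fst e \<in> f ` {..<4} \<and> snd e \<in> f ` {..<4}}"
      using ind by (auto simp: H induced_subgraph_def f_def path_graph_def)
    have iff: "(f i, f j) \<in> parcs G \<longleftrightarrow> j = Suc i \<or> i = Suc j" if "i < 4" "j < 4" for i j
    proof
      assume "(f i, f j) \<in> parcs G"
      then have "(f i, f j) \<in> iso_arcs h ` parcs (path_graph 4)"
        using that unfolding arcs_H by auto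
      then obtain k l where kl: "(k, l) \<in> parcs (path_graph 4)" "(f i, f j) = (f k, f l)"
        using arcs_h by fastforce
      then have "k < 4" "l < 4" by (auto simp: path_graph_def)
      then have "i = k" "j = l"
        using kl that f_inj by (auto dest: inj_onD)
      then show "j = Suc i \<or> i = Suc j" using kl by (auto simp: path_graph_def)
    next
      assume "j = Suc i \<or> i = Suc j"
      then have *: "(i, j) \<in> parcs (path_graph 4)" using that by (auto simp: path_graph_def)
      then have "iso_arcs h (i, j) \<in> parcs G" using arcs_H by blast
      then show "(f i, f j) \<in> parcs G" using arcs_h[OF *] by simp
    qed
    have "f ` {..<4} \<subseteq> pverts G"
      using ind by (auto simp: H induced_subgraph_def subgraph_def f_def path_graph_def)
    then have "induced_P4 (parcs G) (pverts G) (f 0) (f 1) (f 2) (f 3)"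
      by (auto simp: induced_P4_def iff)
    then show ?thesis by blast
  qed
  moreover have "\<exists>H. induced_subgraph H (with_proj G) \<and> digraph_iso (with_proj (path_graph 4)) H"
    if P4: "induced_P4 (parcs G) (pverts G) a b c d" for a b c d
  proof -
    define f where "f i = [a, b, c, d] ! i" for i
    define h where "h = \<lparr>iso_verts = f, iso_arcs = map_prod f f, iso_head = snd, iso_tail = fst\<rparr>"
    have four: "{..<4} = {0, 1, 2, 3 :: nat}" by auto
    have f_simps: "f 0 = a" "f 1 = b" "f 2 = c" "f 3 = d" "f (Suc 0) = b"
      by (auto simp: f_def)
    have arcs: "(a, b) \<in> parcs G" "(b, c) \<in> parcs G" "(c, d) \<in> parcs G"
        "(b, a) \<in> parcs G" "(c, b) \<in> parcs G" "(d, c) \<in> parcs G"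
      and non_arcs: "(a, c) \<notin> parcs G" "(a, d) \<notin> parcs G" "(b, d) \<notin> parcs G"
        "(c, a) \<notin> parcs G" "(d, a) \<notin> parcs G" "(d, b) \<notin> parcs G"
      using P4 sym by (auto simp: induced_P4_def)
    \<comment> \<open>Adjacent vertices differ since there are no loops. Each nonadjacent pair is
      told apart by a third vertex: \<open>d\<close> is adjacent to \<open>c\<close> but not to
      \<open>a\<close>, and so on.\<close>
    have "distinct [a, b, c, d]"
      using arcs non_arcs irrefl by auto
    have adj_iff: "(x, y) \<in> parcs G \<longleftrightarrow> (x, y) \<in> {(a, b), (b, a), (b, c), (c, b), (c, d), (d, c)}"
      if "x \<in> {a, b, c, d}" "y \<in> {a, b, c, d}" for x y
      using that \<open>distinct [a, b, c, d]\<close>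
      by (elim insertE emptyE) (auto simp: arcs non_arcs irrefl)
    have inj: "inj_on f {..<4}"
      using \<open>distinct [a, b, c, d]\<close> by (simp add: four f_simps)
    have parcs_path: "parcs (path_graph 4) = {(0, 1), (1, 0), (1, 2), (2, 1), (2, 3), (3, 2)}"
      by (auto simp: path_graph_def)
    have "induced_subgraph (with_proj G \<restriction> f ` {..<4}) (with_proj G)"
      using P4 by (intro induced_induce) (auto simp: four f_simps induced_P4_def)
    moreover have "path.digraph_isomorphism h"
      unfolding path.digraph_isomorphism_def
    proof (intro conjI)
      show "inj_on (iso_arcs h) (parcs (path_graph 4))"
        using inj_on_subset[OF map_prod_inj_on[OF inj inj], of "parcs (path_graph 4)"]
        by (simp add: h_def path_graph_def subset_iff)
    qed (use inj path.wf_digraph_axioms in \<open>auto simp: h_def path_graph_def\<close>)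
    moreover have "with_proj G \<restriction> f ` {..<4} = app_iso h (with_proj (path_graph 4))"
    proof (rule pre_digraph.equality)
      show "arcs (with_proj G \<restriction> f ` {..<4}) = arcs (app_iso h (with_proj (path_graph 4)))"
      proof -
        have "f ` {..<4} = {a, b, c, d}"
          by (simp add: four f_simps)
        moreover have "arcs (with_proj G \<restriction> V) = parcs G \<inter> V \<times> V" for V
          by auto
        ultimately have "arcs (with_proj G \<restriction> f ` {..<4}) = parcs G \<inter> {a, b, c, d} \<times> {a, b, c, d}"
          by metis
        also have "\<dots> = {(a, b), (b, a), (b, c), (c, b), (c, d), (d, c)}"
          using adj_iff by blast
        also have "\<dots> = map_prod f f ` parcs (path_graph 4)"
          by (simp add: parcs_path f_simps)
        finally show ?thesis by (simp add: h_def)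
      qed
    qed (auto simp: h_def path_graph_def)
    ultimately show ?thesis
      by (auto simp: digraph_iso_def)
  qed
  ultimately show ?thesis
    unfolding cograph_def by blast
qed

lemma cograph_power_graph_induce_iff:
  assumes "finite (carrier G)" "S \<subseteq> carrier G"
  shows "cograph (with_proj (power_graph G) \<restriction> S) \<longleftrightarrow>
    (\<nexists>a b c d. induced_P4 (parcs (power_graph G)) S a b c d)"
proof -
  interpret G: pair_graph "power_graph G"
    using assms(1) by (rule pair_graph_power_graph)
  \<comment> \<open>Writing the induced subgraph as \<open>with_proj\<close> of a pair graph makes
    the preceding lemma applicable to it.\<close>
  define Q where "Q = \<lparr>pverts = S, parcs = parcs (power_graph G) \<inter> S \<times> S\<rparr>"
  have Q: "with_proj (power_graph G) \<restriction> S = with_proj Q"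
    by (auto simp: Q_def induce_subgraph_def with_proj_def)
  have "pair_graph Q"
  proof -
    have "symmetric (with_proj Q)"
      by (auto simp: symmetric_def Q_def intro!: symI G.arcs_symmetric)
    then show ?thesis
      using assms G.no_loops
      by unfold_locales (auto simp: Q_def finite_subset)
  qed
  from pair_graph.cograph_iff_no_induced_P4[OF this] show ?thesis
    unfolding Q by (auto simp: induced_P4_def Q_def)
qed

text \<open>The power comes first: \<open>is_power G y x\<close> is the arrow from \<open>x\<close>
  to \<open>y\<close>.\<close>

definition is_power :: "('a, 'b) monoid_scheme \<Rightarrow> 'a \<Rightarrow> 'a \<Rightarrow> bool" where
  "is_power G y x \<longleftrightarrow> (\<exists>n::nat. y = x [^]\<^bsub>G\<^esub> n)"

lemma parcs_power_graph_iff: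
  "(u, v) \<in> parcs (power_graph G) \<longleftrightarrow>
     u \<in> carrier G \<and> v \<in> carrier G \<and> u \<noteq> v \<and> (is_power G u v \<or> is_power G v u)"
  by (simp add: power_graph_def is_power_def)

section \<open>Powers and element orders\<close>

context group
begin

lemma is_power_refl: "x \<in> carrier G \<Longrightarrow> is_power G x x"
  unfolding is_power_def by (rule exI[of _ 1]) simp

lemma is_power_trans:
  assumes "is_power G x y" "is_power G y z" "z \<in> carrier G"
  shows "is_power G x z"
  using assms by (auto simp: is_power_def nat_pow_pow)

lemma is_power_ord_dvd: "is_power G y x \<Longrightarrow> x \<in> carrier G \<Longrightarrow> ord y dvd ord x"
  by (auto simp: is_power_def ord_pow_gen div_dvd_iff_mult)

text \<open>In the finite cyclic group generated by \<open>z\<close>, the solutions of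
  \<open>g [^] ord y = \<one>\<close> are exactly the powers of \<open>y\<close>, and
  \<open>x\<close> is one of them. Finite order is expressed by
  \<open>ord z \<noteq> 0\<close>.\<close>

lemma is_power_if_ord_dvd:
  assumes z: "z \<in> carrier G" "ord z \<noteq> 0"
    and x: "is_power G x z" and y: "is_power G y z" and dvd: "ord x dvd ord y"
  shows "is_power G x y"
proof -
  obtain i j :: nat where ij: "x = z [^] i" "y = z [^] j"
    using x y by (auto simp: is_power_def)
  define m where "m = ord y"
  have "z [^] (i * m) = \<one>"
    using dvd z ij by (metis m_def nat_pow_pow pow_eq_id nat_pow_closed)
  then have im: "ord z dvd i * m"
    using z by (simp add: pow_eq_id)
  have jm: "ord z = gcd (ord z) j * m"
    using z by (cases "j = 0") (auto simp: m_def ij ord_pow_gen)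
  have "m \<noteq> 0" using jm z(2) by (metis mult_0_right)
  then have "gcd (ord z) j dvd i"
    using im by (subst (asm) jm) simp
  then obtain t where t: "i = gcd (ord z) j * t" ..
  show ?thesis
  \<comment> \<open>Bezout over the naturals needs \<open>j \<noteq> 0\<close>. For
    \<open>j = 0\<close> the gcd is \<open>ord z\<close>, so both elements are the identity.\<close>
  proof (cases "j = 0")
    case True
    then have "x = y [^] (0::nat)"
      using z t by (simp add: ij flip: nat_pow_pow)
    then show ?thesis unfolding is_power_def by blast
  next
    case False
    from bezout_nat[OF this, of "ord z"] obtain k l where "j * k = ord z * l + gcd j (ord z)"
      by blast
    then have "j * k * t = (ord z * l + gcd j (ord z)) * t" by simp
    then have "j * (k * t) = ord z * (l * t) + i"
      by (subst t) (simp add: gcd.commute algebra_simps)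
    then have "y [^] (k * t) = x"
      using z by (simp add: ij nat_pow_pow flip: nat_pow_mult) (simp add: pow_eq_id)
    then show ?thesis by (auto simp: is_power_def)
  qed
qed

lemma ex_power_of_ord:
  assumes "z \<in> carrier G" "ord z \<noteq> 0" "d dvd ord z"
  obtains x where "x \<in> carrier G" "is_power G x z" "ord x = d"
proof
  show "is_power G (z [^] (ord z div d)) z" by (auto simp: is_power_def)
  show "ord (z [^] (ord z div d)) = d"
    using assms by (subst ord_pow) (auto simp: dvd_div_eq_0_iff)
qed (use assms in auto)


lemma is_power_sym_if_ord_dvd:
  assumes "is_power G y x" "x \<in> carrier G" "ord x \<noteq> 0" "ord x dvd ord y"
  shows "is_power G x y"
  using assms is_power_if_ord_dvd is_power_refl by blast

lemma P2_set_iff: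
  "x \<in> P2_set G \<longleftrightarrow> x \<in> carrier G \<and>
     (prime (ord x) \<or> (\<exists>p q::nat. prime p \<and> prime q \<and> ord x = p * q))"
  by (auto simp: P2_set_def)

section \<open>Moving induced paths into \<open>P2_set G\<close>\<close>

lemma induced_P4_P2_set_if_three_primes:
  fixes u v w :: nat
  assumes x: "x \<in> carrier G" "ord x \<noteq> 0" and primes: "prime u" "prime v" "prime w"
    and neq: "u \<noteq> v" "u \<noteq> w" and dvd: "u * v * w dvd ord x"
  shows "\<exists>a b c d. induced_P4 (parcs (power_graph G)) (P2_set G) a b c d"
proof -
  have dvds: "u dvd ord x" "u * v dvd ord x" "v dvd ord x" "v * w dvd ord x"
    using dvd by (auto elim!: dvdE)
  obtain a where a: "a \<in> carrier G" "is_power G a x" "ord a = u"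
    using ex_power_of_ord[OF x dvds(1)] .
  obtain b where b: "b \<in> carrier G" "is_power G b x" "ord b = u * v"
    using ex_power_of_ord[OF x dvds(2)] .
  obtain c where c: "c \<in> carrier G" "is_power G c x" "ord c = v"
    using ex_power_of_ord[OF x dvds(3)] .
  obtain d where d: "d \<in> carrier G" "is_power G d x" "ord d = v * w"
    using ex_power_of_ord[OF x dvds(4)] .
  \<comment> \<open>A power has an order dividing that of its base, so the three nonadjacencies
    reduce to failures of divisibility. The case \<open>v = w\<close> is included.\<close>
  have u_ndvd: "\<not> u dvd v" "\<not> u dvd v * w"
    using primes neq by (auto simp: prime_dvd_mult_iff primes_dvd_imp_eq)
  have "\<not> v dvd u"
    using primes neq primes_dvd_imp_eq by blast
  moreover have "\<not> v * w dvd u * v"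
    using primes neq primes_dvd_imp_eq[of w u] by (auto simp: mult.commute[of v])
  moreover have "u * v \<noteq> u" "u * v \<noteq> v" "v * w \<noteq> v"
    using primes by auto
  moreover have "is_power G a b" "is_power G c b" "is_power G c d"
    using a b c d x by (auto intro: is_power_if_ord_dvd)
  ultimately have "induced_P4 (parcs (power_graph G)) (P2_set G) a b c d"
    \<comment> \<open>These instances exclude that \<open>d\<close> is a power of \<open>a\<close>
      and that \<open>b\<close> is a power of \<open>d\<close>.\<close>
    using a b c d u_ndvd primes dvd_mult_left[of v w u] dvd_mult_left[of u v "v * w"]
    by (auto simp: induced_P4_def P2_set_iff parcs_power_graph_iff dest: is_power_ord_dvd)
  then show ?thesis by blast
qed

lemma ord_eq_mult_primes_if_no_induced_P4:
  fixes p r :: nat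
  assumes x: "x \<in> carrier G" "ord x \<noteq> 0" and primes: "prime p" "prime r" "p \<noteq> r"
    and dvd: "p dvd ord x" "r dvd ord x"
    and no_P4: "\<nexists>a b c d. induced_P4 (parcs (power_graph G)) (P2_set G) a b c d"
  shows "ord x = p * r"
proof -
  have "p * r dvd ord x"
    using primes dvd by (simp add: divides_mult primes_coprime)
  then obtain n where n: "ord x = p * r * n" ..
  have "n = 1"
  proof (rule ccontr)
    assume "n \<noteq> 1"
    then obtain q where q: "prime q" "q dvd n"
      using prime_factor_nat by blast
    have pq: "p * r * q dvd ord x" "r * p * q dvd ord x"
      using q by (auto simp: n mult.commute[of r])
    show False
    \<comment> \<open>The first of the three primes must differ from the other two: \<open>r\<close>
      does if \<open>q = p\<close>, and otherwise \<open>p\<close> does, even when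
      \<open>q = r\<close>.\<close>
    proof (cases "q = p")
      case True
      then show False
        using induced_P4_P2_set_if_three_primes[OF x, of r p q] primes q pq no_P4 by auto
    next
      case False
      then show False
        using induced_P4_P2_set_if_three_primes[OF x, of p r q] primes q pq no_P4 by auto
    qed
  qed
  then show ?thesis using n by simp
qed

lemma induced_P4_P2_set_if_oriented:
  assumes fin: "finite (carrier G)"
    and P4: "induced_P4 (parcs (power_graph G)) (carrier G) a b c d"
    and pow: "is_power G a b" "is_power G c b" "is_power G c d"
  shows "\<exists>a b c d. induced_P4 (parcs (power_graph G)) (P2_set G) a b c d"
proof (rule ccontr)
  assume no_P4: "\<not> ?thesis"
  have ord0: "ord x \<noteq> 0" if "x \<in> carrier G" for x
    using ord_ge_1[OF fin that] by simp
  have car: "a \<in> carrier G" "b \<in> carrier G" "c \<in> carrier G" "d \<in> carrier G"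
    using P4 by (auto simp: induced_P4_def)
  have adj: "(a, b) \<in> parcs (power_graph G)"
      "(b, c) \<in> parcs (power_graph G)" "(c, d) \<in> parcs (power_graph G)"
    and nadj: "(a, c) \<notin> parcs (power_graph G)"
      "(a, d) \<notin> parcs (power_graph G)" "(b, d) \<notin> parcs (power_graph G)"
    using P4 by (auto simp: induced_P4_def)
  have "a \<noteq> c" "a \<noteq> d" "b \<noteq> d"
    using adj nadj by (auto simp: parcs_power_graph_iff)
  then have npow: "\<not> is_power G a c" "\<not> is_power G c a"
      "\<not> is_power G a d" "\<not> is_power G b d" "\<not> is_power G d b"
    using car nadj by (auto simp: parcs_power_graph_iff)
  \<comment> \<open>Both \<open>a\<close> and \<open>c\<close> are powers of \<open>b\<close>, so
    being incomparable as powers means having incomparable orders.\<close>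
  have ndvd: "\<not> ord a dvd ord c" "\<not> ord c dvd ord a"
    using npow pow is_power_if_ord_dvd car ord0 by blast+
  have dvd_b: "ord a dvd ord b" "ord c dvd ord b"
    using pow car by (auto intro: is_power_ord_dvd)
  obtain p where p: "prime p" "multiplicity p (ord a) < multiplicity p (ord c)"
    using ndvd(2) ord0 car multiplicity_le_imp_dvd[of "ord c" "ord a"] by (meson not_le)
  obtain r where r: "prime r" "multiplicity r (ord c) < multiplicity r (ord a)"
    using ndvd(1) ord0 car multiplicity_le_imp_dvd[of "ord a" "ord c"] by (meson not_le)
  have "p \<noteq> r" using p r by auto
  have p_dvd: "p dvd ord c" and r_dvd: "r dvd ord a"
    using p r by (metis not_dvd_imp_multiplicity_0 not_less_zero)+
  have ord_b: "ord b = p * r"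
    using ord_eq_mult_primes_if_no_induced_P4[OF car(2) ord0[OF car(2)] p(1) r(1) \<open>p \<noteq> r\<close> _ _ no_P4]
      p_dvd r_dvd dvd_b dvd_trans by blast
  \<comment> \<open>The cofactor of \<open>p\<close> divides \<open>r\<close>. If it were
    \<open>r\<close>, then \<open>ord c = ord b\<close>, which \<open>ord a\<close> divides.\<close>
  have ord_c: "ord c = p"
  proof -
    obtain k where k: "ord c = p * k" using p_dvd ..
    then have "k dvd r" using dvd_b(2) p(1) by (simp add: ord_b)
    moreover have "k \<noteq> r" using ndvd(1) dvd_b(1) k ord_b by auto
    ultimately show ?thesis using r(1) k by (auto simp: prime_nat_iff)
  qed
  have ord_a: "ord a = r"
  proof -
    obtain k where k: "ord a = r * k" using r_dvd ..
    then have "k dvd p" using dvd_b(1) r(1) by (simp add: ord_b mult.commute[of p])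
    moreover have "k \<noteq> p" using ndvd(2) dvd_b(2) k ord_b by (auto simp: mult.commute)
    ultimately show ?thesis using p(1) k by (auto simp: prime_nat_iff)
  qed
  have "p dvd ord d"
    using pow(3) car(4) ord_c is_power_ord_dvd by blast
  then obtain n where n: "ord d = p * n" ..
  \<comment> \<open>Otherwise \<open>c\<close> and \<open>d\<close> generate the same subgroup, so
    \<open>d\<close> is a power of \<open>b\<close>.\<close>
  have "n \<noteq> 1"
  proof
    assume "n = 1"
    then have "is_power G d c"
      using is_power_sym_if_ord_dvd[OF pow(3) car(4) ord0[OF car(4)]] n ord_c by simp
    then show False using npow(5) pow(2) car is_power_trans by blast
  qed
  then obtain q where q: "prime q" "q dvd n"
    using prime_factor_nat by blast
  have "p * q dvd ord d" using q n by simp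
  then obtain e where e: "e \<in> carrier G" "is_power G e d" "ord e = p * q"
    using ex_power_of_ord[OF car(4) ord0[OF car(4)]] by blast
  have ce: "is_power G c e"
    using is_power_if_ord_dvd[OF car(4) ord0[OF car(4)] pow(3) e(2)] by (simp add: ord_c e)
  have ae: "\<not> is_power G a e" and be: "\<not> is_power G b e"
    using npow e(2) car is_power_trans by blast+
  \<comment> \<open>Either \<open>p * p\<close> fails to divide \<open>ord b\<close>, or the absence
    of paths forces \<open>ord d = p * q\<close>. Then \<open>d\<close> is a power of
    \<open>e\<close>, so \<open>e\<close> inherits from \<open>d\<close> that it is no power of
    \<open>b\<close>.\<close>
  have eb: "\<not> is_power G e b"
  proof (cases "q = p")
    case True
    have "\<not> p * p dvd p * r"
      using p(1) r(1) \<open>p \<noteq> r\<close> primes_dvd_imp_eq[of p r] by auto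
    then show ?thesis
      using is_power_ord_dvd[of e b] car(2) e(3) ord_b True by auto
  next
    case False
    have "ord d = p * q"
      using ord_eq_mult_primes_if_no_induced_P4[OF car(4) ord0[OF car(4)] p(1) q(1) _ _ _ no_P4] False n q
      by auto
    then have "is_power G d e"
      using is_power_sym_if_ord_dvd[OF e(2) car(4) ord0[OF car(4)]] e(3) by simp
    then show ?thesis using npow(5) car is_power_trans by blast
  qed
  have ea: "\<not> is_power G e a"
    using eb pow(1) car is_power_trans by blast
  have "c \<noteq> e" using ord_c e(3) p(1) q(1) by auto
  then have "induced_P4 (parcs (power_graph G)) (P2_set G) a b c e"
    using adj nadj car e ce ae be ea eb p(1) q(1) r(1) ord_a ord_b ord_c
    by (auto simp: induced_P4_def P2_set_iff parcs_power_graph_iff)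
  then show False using no_P4 by blast
qed

lemma induced_P4_P2_set:
  assumes fin: "finite (carrier G)"
    and P4: "induced_P4 (parcs (power_graph G)) (carrier G) a b c d"
  shows "\<exists>a b c d. induced_P4 (parcs (power_graph G)) (P2_set G) a b c d"
proof -
  have rev: "induced_P4 (parcs (power_graph G)) (carrier G) d c b a"
    using P4 by (auto simp: induced_P4_def parcs_power_graph_iff)
  \<comment> \<open>Two consecutive arrows in the same direction would compose to a chord, so
    directions alternate along the path.\<close>
  have "is_power G a b \<and> is_power G c b \<and> is_power G c d \<or>
        is_power G d c \<and> is_power G b c \<and> is_power G b a"
    using P4 unfolding induced_P4_def parcs_power_graph_iff
    by (metis insert_subset is_power_trans)
  then show ?thesis
    using induced_P4_P2_set_if_oriented[OF fin P4] induced_P4_P2_set_if_oriented[OF fin rev] by blast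
qed

end

theorem corollary3p3:
  fixes G :: "('a, 'b) monoid_scheme"
  assumes "group G" and "finite (carrier G)"
  shows "cograph (with_proj (power_graph G)) \<longleftrightarrow>
         cograph (with_proj (power_graph G) \<restriction> P2_set G)"
proof -
  interpret group G by fact
  have P2: "P2_set G \<subseteq> carrier G" by (auto simp: P2_set_def)
  have "pverts (power_graph G) = carrier G" by (simp add: power_graph_def)
  then have "cograph (with_proj (power_graph G)) \<longleftrightarrow>
      (\<nexists>a b c d. induced_P4 (parcs (power_graph G)) (carrier G) a b c d)"
    using pair_graph.cograph_iff_no_induced_P4[OF pair_graph_power_graph[OF assms(2)]] by simp
  also have "\<dots> \<longleftrightarrow> (\<nexists>a b c d. induced_P4 (parcs (power_graph G)) (P2_set G) a b c d)"
    using induced_P4_P2_set[OF assms(2)] induced_P4_mono[OF _ P2] by blast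
  also have "\<dots> \<longleftrightarrow> cograph (with_proj (power_graph G) \<restriction> P2_set G)"
    using cograph_power_graph_induce_iff[OF assms(2) P2] by simp
  finally show ?thesis .
qed

end
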